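(* For disjunctive systems with process templates $A,B$ and a state $q\in Q_B$, $|B|$ is a cutoff for checking $\textsc{Target}(q)$ and $\textsc{Repeat-Target}(q)$: for all $n\ge|B|$, $(A,B)^{(1,n)}$ has a run in which eventually all $B$-processes are in $q$ simultaneously iff $(A,B)^{(1,|B|)}$ has such a run; and $(A,B)^{(1,n)}$ has a run in which infinitely often all $B$-processes are in $q$ simultaneously iff $(A,B)^{(1,|B|)}$ has such a run.
   Context: A process template is $U=(Q_U,\mathit{init}_U,\Sigma_U,\delta_U)$ with finite state set, initial state, finite input alphabet and guarded transitions $\delta_U\subseteq Q_U\times\Sigma_U\times\mathcal P(Q_A\,\dot\cup\,Q_B)\times Q_U$; $A,B$ have disjoint state sets; $|B|=|Q_B|$. The disjunctive system $(A,B)^{(1,n)}$ consists of one copy of $A$ and $n$ copies $B_1,\dots,B_n$ of $B$ in interleaving composition starting with all processes in their initial states; in a step one process $p$ takes a local transition $(q_p,\sigma_p,g,q_p')$ from its current state with its current input, allowed iff some other process $p'\neq p$ is in a state of $g$; inputs of a process remain unchanged unless it moves; runs are maximal such paths. $\textsc{Target}(q)$ is the property $\mathsf F\,\forall i.\,q_i$ (some run reaches a global state where all $B$-processes are in $q$), $\textsc{Repeat-Target}(q)$ is $\mathsf{GF}\,\forall i.\,q_i$.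
   Formalization: Repeat-Target is proved as GF over maximal runs (a finite deadlocked run counts if its last state has all B-processes in q); with "infinitely often" taken literally the claim is proved for |B| ≥ 2, as it fails for |B| = 1 (a self-loop guarded by q needs a second copy). *)

theory Defs
  imports Main "HOL-Library.Extended_Nat"
begin

record ('s, 'i) process_template =
  states :: "'s set"
  init :: 's
  inputs :: "'i set"
  transitions :: "('s \<times> 'i \<times> 's set \<times> 's) set"

(* The templates A and B share one state type and one input type, so that guards are
   plain sets of states; disjointness of the two state sets is an explicit condition. *)

definition process_template_over :: "'s set \<Rightarrow> ('s, 'i) process_template \<Rightarrow> bool" where
  "process_template_over G U \<longleftrightarrow>
     finite (states U) \<and> init U \<in> states U \<and> finite (inputs U) \<and>
     transitions U \<subseteq> states U \<times> inputs U \<times> Pow G \<times> states U"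

definition template_pair :: "('s, 'i) process_template \<Rightarrow> ('s, 'i) process_template \<Rightarrow> bool" where
  "template_pair A B \<longleftrightarrow>
     states A \<inter> states B = {} \<and>
     process_template_over (states A \<union> states B) A \<and>
     process_template_over (states A \<union> states B) B"

datatype proc = PA | PB nat

definition procs :: "nat \<Rightarrow> proc set" where
  "procs n = insert PA (PB ` {1..n})"

fun template_of ::
  "('s, 'i) process_template \<Rightarrow> ('s, 'i) process_template \<Rightarrow> proc \<Rightarrow> ('s, 'i) process_template"
where
  "template_of A B PA = A"
| "template_of A B (PB i) = B"

(* A global state together with a global input. Both are functions on all of proc;
   their values outside procs n are irrelevant and left unconstrained. *)
type_synonym ('s, 'i) config = "(proc \<Rightarrow> 's) \<times> (proc \<Rightarrow> 'i)"

definition valid_config ::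
  "('s, 'i) process_template \<Rightarrow> ('s, 'i) process_template \<Rightarrow> nat \<Rightarrow> ('s, 'i) config \<Rightarrow> bool"
where
  "valid_config A B n c \<longleftrightarrow>
     (\<forall>p\<in>procs n. fst c p \<in> states (template_of A B p) \<and> snd c p \<in> inputs (template_of A B p))"

(* The moving process receives an arbitrary new input; all other inputs are kept. *)
definition moves ::
  "('s, 'i) process_template \<Rightarrow> ('s, 'i) process_template \<Rightarrow> nat \<Rightarrow> proc \<Rightarrow>
   ('s, 'i) config \<Rightarrow> ('s, 'i) config \<Rightarrow> bool"
where
  "moves A B n p c c' \<longleftrightarrow>
     p \<in> procs n \<and> valid_config A B n c \<and> valid_config A B n c' \<and>
     (\<exists>g. (fst c p, snd c p, g, fst c' p) \<in> transitions (template_of A B p) \<and>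
          (\<exists>p'\<in>procs n. p' \<noteq> p \<and> fst c p' \<in> g)) \<and>
     (\<forall>p'\<in>procs n. p' \<noteq> p \<longrightarrow> fst c' p' = fst c p' \<and> snd c' p' = snd c p')"

definition step ::
  "('s, 'i) process_template \<Rightarrow> ('s, 'i) process_template \<Rightarrow> nat \<Rightarrow>
   ('s, 'i) config \<Rightarrow> ('s, 'i) config \<Rightarrow> bool"
where
  "step A B n c c' \<longleftrightarrow> (\<exists>p. moves A B n p c c')"

definition initial_config ::
  "('s, 'i) process_template \<Rightarrow> ('s, 'i) process_template \<Rightarrow> nat \<Rightarrow> ('s, 'i) config \<Rightarrow> bool"
where
  "initial_config A B n c \<longleftrightarrow>
     valid_config A B n c \<and> (\<forall>p\<in>procs n. fst c p = init (template_of A B p))"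

(* A finite or infinite nonempty sequence of configurations is a length L together with
   a function x of which only the values x m with m < L matter. A run is infinite or
   ends in a configuration without successor (a global deadlock). *)
definition is_run ::
  "('s, 'i) process_template \<Rightarrow> ('s, 'i) process_template \<Rightarrow> nat \<Rightarrow>
   enat \<Rightarrow> (nat \<Rightarrow> ('s, 'i) config) \<Rightarrow> bool"
where
  "is_run A B n L x \<longleftrightarrow>
     0 < L \<and> initial_config A B n (x 0) \<and>
     (\<forall>m. enat (Suc m) < L \<longrightarrow> step A B n (x m) (x (Suc m))) \<and>
     (\<forall>m. L = enat (Suc m) \<longrightarrow> \<not> (\<exists>c'. step A B n (x m) c'))"

definition all_B_in :: "nat \<Rightarrow> 's \<Rightarrow> ('s, 'i) config \<Rightarrow> bool" where
  "all_B_in n q c \<longleftrightarrow> (\<forall>i\<in>{1..n}. fst c (PB i) = q)"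

(* LTL operators on finite or infinite sequences; on a finite sequence,
   GF P says that P holds in the last position. *)
definition ltl_F :: "enat \<Rightarrow> (nat \<Rightarrow> 'c) \<Rightarrow> ('c \<Rightarrow> bool) \<Rightarrow> bool" where
  "ltl_F L x P \<longleftrightarrow> (\<exists>m. enat m < L \<and> P (x m))"

definition ltl_GF :: "enat \<Rightarrow> (nat \<Rightarrow> 'c) \<Rightarrow> ('c \<Rightarrow> bool) \<Rightarrow> bool" where
  "ltl_GF L x P \<longleftrightarrow> (\<forall>m. enat m < L \<longrightarrow> (\<exists>k\<ge>m. enat k < L \<and> P (x k)))"

definition has_target_run ::
  "('s, 'i) process_template \<Rightarrow> ('s, 'i) process_template \<Rightarrow> 's \<Rightarrow> nat \<Rightarrow> bool"
where
  "has_target_run A B q n \<longleftrightarrow> (\<exists>L x. is_run A B n L x \<and> ltl_F L x (all_B_in n q))"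

definition has_repeat_target_run ::
  "('s, 'i) process_template \<Rightarrow> ('s, 'i) process_template \<Rightarrow> 's \<Rightarrow> nat \<Rightarrow> bool"
where
  "has_repeat_target_run A B q n \<longleftrightarrow> (\<exists>L x. is_run A B n L x \<and> ltl_GF L x (all_B_in n q))"

(* Unlike has_repeat_target_run, this excludes runs that deadlock with all B-processes in q.
   With this variant, card (states B) is not a cutoff if states B = {q}: let A have no
   transitions and B only a self-loop with guard {q}. Then two copies of B run forever,
   while a single copy is deadlocked from the start. *)
definition has_infinitely_often_target_run ::
  "('s, 'i) process_template \<Rightarrow> ('s, 'i) process_template \<Rightarrow> 's \<Rightarrow> nat \<Rightarrow> bool"
where
  "has_infinitely_often_target_run A B q n \<longleftrightarrow>
     (\<exists>L x. is_run A B n L x \<and> infinite {m. enat m < L \<and> all_B_in n q (x m)})"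

definition is_cutoff :: "nat \<Rightarrow> (nat \<Rightarrow> bool) \<Rightarrow> bool" where
  "is_cutoff c P \<longleftrightarrow> (\<forall>n\<ge>c. P n \<longleftrightarrow> P c)"

end

theory Submission
  imports Defs
begin

text \<open>
  Both systems are compared through paths of global states. A path of the system with \<open>n\<close> copies of
  \<open>B\<close> is simulated with \<open>m \<ge> |B|\<close> copies by assigning every state \<open>u\<close> of \<open>B\<close> to some copy: it
  follows the first process that reaches \<open>u\<close>, waits in \<open>u\<close> while \<open>u\<close> is needed, and then follows the
  last process that leaves \<open>u\<close>. Whenever a guard is satisfied in the original path by a process in
  \<open>u\<close>, the copy assigned to \<open>u\<close> is waiting there and is not about to move. Since \<open>n\<close> is arbitrary,
  this gives both directions of a cutoff. An infinite run that is infinitely often in the target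
  yields a cycle through a target state, which is simulated in the same way; only a cycle of self-loops in \<open>q\<close> guarded by
  \<open>q\<close> requires a second copy. Deadlocks in the target depend only on the state and input of \<open>A\<close> and
  the input of a single copy of \<open>B\<close>, again provided that there are at least two copies; if \<open>|B| = 1\<close>,
  every run is in the target all the time.
\<close>

section \<open>Trajectories that wait in a fixed state\<close>

text \<open>Follow \<open>f\<close>, which is in \<open>u\<close> at the first occurrence of
  \<open>u\<close>, wait in \<open>u\<close> until its last occurrence, then follow
  \<open>l\<close>, which is in \<open>u\<close> at that time. Every change thus copies a
  simultaneous change of some original process. The conditions at times 0 and \<open>N\<close> later
  preserve uniform endpoints.\<close>

lemma shadow_trajectory:
  fixes b :: "nat \<Rightarrow> 'j \<Rightarrow> 's"
  assumes "J \<noteq> {}"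
  obtains \<tau> where
    "\<And>t. t < N \<Longrightarrow> \<tau> (Suc t) = \<tau> t \<or> (\<exists>j\<in>J. \<tau> t = b t j \<and> \<tau> (Suc t) = b (Suc t) j)"
    "\<tau> 0 \<in> b 0 ` J" "\<tau> N \<in> b N ` J"
    "\<And>t j. t \<le> N \<Longrightarrow> j \<in> J \<Longrightarrow> b t j = u \<Longrightarrow> \<tau> t = u"
proof (cases "\<exists>t\<le>N. u \<in> b t ` J")
  case False
  obtain j where "j \<in> J" using assms by blast
  \<comment> \<open>If \<open>u\<close> never occurs, covering is vacuous and any process may be
    followed throughout.\<close>
  with False show ?thesis by (intro that[of "\<lambda>t. b t j"]) auto
next
  case True
  define occ where "occ = {t. t \<le> N \<and> u \<in> b t ` J}"
  have "finite occ" "occ \<noteq> {}" using True by (auto simp: occ_def)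
  then have mM: "Min occ \<in> occ" "Max occ \<in> occ" and bounds: "\<And>t. t \<in> occ \<Longrightarrow> Min occ \<le> t \<and> t \<le> Max occ"
    by auto
  then obtain f l where f: "f \<in> J" "b (Min occ) f = u" and l: "l \<in> J" "b (Max occ) l = u"
    by (auto simp: occ_def)
  have MN: "Max occ \<le> N" "Min occ \<le> Max occ" using mM bounds by (auto simp: occ_def)
  define \<tau> where
    "\<tau> t = (if t < Min occ then b t f else if t \<le> Max occ then u else b t l)" for t
  show ?thesis
  proof (rule that[of \<tau>])
    fix t assume "t < N"
    consider "Suc t < Min occ" | "Suc t = Min occ" | "Min occ \<le> t" "t < Max occ" | "t = Max occ" | "Max occ < t"
      by linarith
    then show "\<tau> (Suc t) = \<tau> t \<or> (\<exists>j\<in>J. \<tau> t = b t j \<and> \<tau> (Suc t) = b (Suc t) j)"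
    proof cases
      \<comment> \<open>The copy leaves \<open>u\<close> at the last occurrence, together with
        \<open>l\<close>.\<close>
      case 4
      then show ?thesis using l MN by (intro disjI2 bexI[of _ l]) (auto simp: \<tau>_def)
    qed (use f l MN in \<open>auto simp: \<tau>_def\<close>)
  next
    have "\<tau> 0 = b 0 f" using f by (auto simp: \<tau>_def)
    then show "\<tau> 0 \<in> b 0 ` J" using f by auto
  next
    have "\<tau> N = b N l" using l MN by (auto simp: \<tau>_def)
    then show "\<tau> N \<in> b N ` J" using l by auto
  next
    fix t j assume "t \<le> N" "j \<in> J" "b t j = u"
    then have "t \<in> occ" by (auto simp: occ_def)
    then show "\<tau> t = u" using bounds by (auto simp: \<tau>_def dest: leD)
  qed
qed

section \<open>Paths and lassos of a relation\<close>

lemma rtranclp_chain: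
  assumes "\<And>t. t < k \<Longrightarrow> R\<^sup>*\<^sup>* (y t) (y (Suc t))" "i \<le> j" "j \<le> k"
  shows "R\<^sup>*\<^sup>* (y i) (y j)"
  using assms(2,3)
proof (induction j rule: dec_induct)
  case (step j)
  then show ?case using assms(1)[of j] by (auto intro: rtranclp_trans)
qed simp

text \<open>An explicit indexing by time, since the simulation has to speak of first and last
  occurrences.\<close>

definition is_path :: "('a \<Rightarrow> 'a \<Rightarrow> bool) \<Rightarrow> nat \<Rightarrow> (nat \<Rightarrow> 'a) \<Rightarrow> 'a \<Rightarrow> 'a \<Rightarrow> bool" where
  "is_path R k f x y \<longleftrightarrow> f 0 = x \<and> f k = y \<and> (\<forall>i<k. R (f i) (f (Suc i)))"

lemma is_pathD:
  assumes "is_path R k f x y"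
  shows "f 0 = x" "f k = y" "\<And>i. i < k \<Longrightarrow> R (f i) (f (Suc i))"
  using assms by (auto simp: is_path_def)

lemma relpowp_iff_path: "(R ^^ k) x y \<longleftrightarrow> (\<exists>f. is_path R k f x y)"
  unfolding relpowp_fun_conv is_path_def by simp

lemma rtranclp_iff_path: "R\<^sup>*\<^sup>* x y \<longleftrightarrow> (\<exists>k f. is_path R k f x y)"
  unfolding rtranclp_power relpowp_iff_path by simp

lemma tranclp_iff_path: "R\<^sup>+\<^sup>+ x y \<longleftrightarrow> (\<exists>k f. 0 < k \<and> is_path R k f x y)"
  unfolding tranclp_power relpowp_iff_path by auto

text \<open>Walk the stem to \<open>c\<close> once and the cycle of length \<open>l\<close> forever;
  \<open>c\<close> recurs at the times \<open>k + i * l\<close>.\<close>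

lemma lasso_sequence:
  assumes "R\<^sup>*\<^sup>* x c" "R\<^sup>+\<^sup>+ c c"
  obtains f where "f 0 = x" "\<And>m. R (f m) (f (Suc m))" "infinite {m. f m = c}"
proof -
  obtain k f where "is_path R k f x c" using assms(1) unfolding rtranclp_iff_path by blast
  note f = is_pathD[OF this]
  obtain l g where l: "0 < l" and "is_path R l g c c" using assms(2) unfolding tranclp_iff_path by blast
  note g = is_pathD[OF this(2)]
  define h where "h m = (if m < k then f m else g ((m - k) mod l))" for m
  show ?thesis
  proof
    show "h 0 = x" using f g by (cases k) (auto simp: h_def)
  next
    fix m
    consider "Suc m < k" | "Suc m = k" | "k \<le> m" by linarith
    then show "R (h m) (h (Suc m))"
    proof cases
      case 3
      have "(m - k) mod l < l" using l by simp
      then have "R (g ((m - k) mod l)) (g (Suc ((m - k) mod l)))" by (rule g)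
      \<comment> \<open>At the wrap-around the residue falls back to 0, which is harmless because
        \<open>g l\<close> and \<open>g 0\<close> are both \<open>c\<close>.\<close>
      moreover have "g (Suc ((m - k) mod l)) = g (Suc (m - k) mod l)"
        using g by (simp add: mod_Suc)
      ultimately show ?thesis using 3 by (simp add: h_def Suc_diff_le)
    qed (use f g in \<open>auto simp: h_def dest: f(3)\<close>)
  next
    have "h (k + i * l) = c" for i using g by (simp add: h_def)
    then have "range (\<lambda>i. k + i * l) \<subseteq> {m. h m = c}" by auto
    moreover have "inj (\<lambda>i. k + i * l)" using l by (auto intro: injI)
    ultimately show "infinite {m. h m = c}"
      by (meson finite_subset range_inj_infinite)
  qed
qed

section \<open>Processes and global states\<close>

lemma PA_in_procs [simp]: "PA \<in> procs n"
  by (simp add: procs_def)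

lemma PB_in_procs [simp]: "PB i \<in> procs n \<longleftrightarrow> 1 \<le> i \<and> i \<le> n"
  by (auto simp: procs_def)

lemma finite_procs [simp]: "finite (procs n)"
  by (simp add: procs_def)

text \<open>Initial and target states have this shape, which makes sense for every number of copies
  and so links systems of different sizes.\<close>

fun uniform :: "'a \<Rightarrow> 'a \<Rightarrow> proc \<Rightarrow> 'a" where
  "uniform a b PA = a"
| "uniform a b (PB i) = b"

text \<open>Values outside \<^term>\<open>procs n\<close> are fixed to \<^term>\<open>undefined\<close>, so that global states can be
  compared by equality.\<close>

definition on_procs :: "nat \<Rightarrow> (proc \<Rightarrow> 'a) \<Rightarrow> proc \<Rightarrow> 'a" where
  "on_procs n s p = (if p \<in> procs n then s p else undefined)"

lemma on_procs_eq_iff: "on_procs n s = on_procs n s' \<longleftrightarrow> (\<forall>p\<in>procs n. s p = s' p)"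
  by (auto simp: on_procs_def fun_eq_iff)

lemma on_procs_apply [simp]: "p \<in> procs n \<Longrightarrow> on_procs n s p = s p"
  by (simp add: on_procs_def)

lemma all_procs_iff: "(\<forall>p\<in>procs n. P p) \<longleftrightarrow> P PA \<and> (\<forall>i\<in>{1..n}. P (PB i))"
  by (auto simp: procs_def)

text \<open>Turns the target condition into an equality of global states, so that two target
  positions with the same state of \<open>A\<close> bound a cycle.\<close>

lemma all_B_in_iff: "all_B_in n q c \<longleftrightarrow> on_procs n (fst c) = on_procs n (uniform (fst c PA) q)"
  by (simp add: all_B_in_def on_procs_eq_iff all_procs_iff)

section \<open>Disjunctive systems and steps without inputs\<close>

locale disjunctive_system =
  fixes A B :: "('s, 'i) process_template"
  assumes pair: "template_pair A B"
begin

abbreviation tmpl :: "proc \<Rightarrow> ('s, 'i) process_template" where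
  "tmpl \<equiv> template_of A B"

lemma transition_closed:
  assumes "(u, \<sigma>, g, r) \<in> transitions (tmpl p)"
  shows "u \<in> states (tmpl p)" "\<sigma> \<in> inputs (tmpl p)" "r \<in> states (tmpl p)"
  using assms pair by (cases p; fastforce simp: template_pair_def process_template_over_def)+

lemma finite_states: "finite (states A)" "finite (states B)"
  using pair by (auto simp: template_pair_def process_template_over_def)

lemma init_states: "init A \<in> states A" "init B \<in> states B"
  using pair by (auto simp: template_pair_def process_template_over_def)

lemma card_B_pos: "1 \<le> card (states B)"
  using finite_states init_states by (metis One_nat_def Suc_leI card_gt_0_iff empty_iff)

definition valid_state :: "nat \<Rightarrow> (proc \<Rightarrow> 's) \<Rightarrow> bool" where
  "valid_state n s \<longleftrightarrow> (\<forall>p\<in>procs n. s p \<in> states (tmpl p))"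

definition valid_input :: "nat \<Rightarrow> (proc \<Rightarrow> 'i) \<Rightarrow> bool" where
  "valid_input n e \<longleftrightarrow> (\<forall>p\<in>procs n. e p \<in> inputs (tmpl p))"

lemma valid_config_iff: "valid_config A B n c \<longleftrightarrow> valid_state n (fst c) \<and> valid_input n (snd c)"
  by (auto simp: valid_config_def valid_state_def valid_input_def)

lemma valid_state_on_procs [simp]: "valid_state n (on_procs n s) \<longleftrightarrow> valid_state n s"
  by (simp add: valid_state_def)

lemma valid_state_uniform: "a \<in> states A \<Longrightarrow> b \<in> states B \<Longrightarrow> valid_state n (uniform a b)"
  by (auto simp: valid_state_def procs_def)

text \<open>A step with the inputs forgotten: since a moving process receives an arbitrary new input,
  every process can be taken to hold already the input its next move needs.\<close>

definition sstep :: "nat \<Rightarrow> (proc \<Rightarrow> 's) \<Rightarrow> (proc \<Rightarrow> 's) \<Rightarrow> bool" where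
  "sstep n s s' \<longleftrightarrow> (\<exists>p\<in>procs n. \<exists>\<sigma> g r. (s p, \<sigma>, g, r) \<in> transitions (tmpl p) \<and>
     (\<exists>p'\<in>procs n. p' \<noteq> p \<and> s p' \<in> g) \<and> s' = s(p := r))"

text \<open>Restriction to \<open>procs n\<close> turns the agreement of all other processes into an
  exact function update.\<close>

lemma step_imp_sstep:
  assumes "step A B n c c'"
  shows "sstep n (on_procs n (fst c)) (on_procs n (fst c'))"
proof -
  obtain p g p' where p: "p \<in> procs n"
    and tr: "(fst c p, snd c p, g, fst c' p) \<in> transitions (tmpl p)"
    and p': "p' \<in> procs n" "p' \<noteq> p" "fst c p' \<in> g"
    and rest: "\<forall>p'\<in>procs n. p' \<noteq> p \<longrightarrow> fst c' p' = fst c p' \<and> snd c' p' = snd c p'"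
    using assms by (auto simp: step_def moves_def)
  have "on_procs n (fst c') = (on_procs n (fst c))(p := fst c' p)"
    using p rest by (auto simp: on_procs_def)
  then show ?thesis unfolding sstep_def using p tr p' by (metis on_procs_apply)
qed

lemma sstep_valid: "sstep n s s' \<Longrightarrow> valid_state n s \<Longrightarrow> valid_state n s'"
  by (auto simp: sstep_def valid_state_def intro: transition_closed)

section \<open>Lifting state paths to configurations\<close>

text \<open>Inputs are reconstructed backwards: the input of the mover after the step is free, so
  \<open>e\<close> can be prescribed there, and only the input \<open>\<sigma>\<close> before the
  step is forced.\<close>

lemma sstep_lift:
  assumes "sstep n s s'" "valid_state n s"
  obtains p \<sigma> where "p \<in> procs n" "\<sigma> \<in> inputs (tmpl p)"
    "\<And>e. valid_input n e \<Longrightarrow> step A B n (s, e(p := \<sigma>)) (s', e)"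
proof -
  obtain p \<sigma> g r where p: "p \<in> procs n" "(s p, \<sigma>, g, r) \<in> transitions (tmpl p)"
    "\<exists>p'\<in>procs n. p' \<noteq> p \<and> s p' \<in> g" and s': "s' = s(p := r)"
    using assms(1) unfolding sstep_def by blast
  have "\<sigma> \<in> inputs (tmpl p)" using p transition_closed by blast
  moreover have "step A B n (s, e(p := \<sigma>)) (s', e)" if "valid_input n e" for e
    unfolding step_def moves_def valid_config_iff
    using that p assms s' sstep_valid[OF assms] \<open>\<sigma> \<in> inputs (tmpl p)\<close>
    by (intro exI[of _ p]) (auto simp: valid_input_def)
  ultimately show ?thesis using that p by blast
qed

text \<open>\<open>M\<close> collects the moving processes, and \<open>\<sigma>\<close> gives each
  of them the input of its first move. That both are independent of the final inputs
  \<open>e\<close> is what later closes cycles.\<close>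

lemma sstep_power_lift:
  assumes "(sstep n ^^ k) s s'" "valid_state n s"
  shows "\<exists>M \<sigma>. \<forall>e. valid_input n e \<longrightarrow>
    valid_input n (override_on e \<sigma> M) \<and> (step A B n ^^ k) (s, override_on e \<sigma> M) (s', e)"
  using assms
proof (induction k arbitrary: s)
  case 0
  then show ?case by (intro exI[of _ "{}"]) (auto simp: override_on_def)
next
  case (Suc k)
  obtain s1 where s1: "sstep n s s1" "(sstep n ^^ k) s1 s'"
    using relpowp_Suc_D2[OF Suc.prems(1)] by blast
  obtain M \<sigma> where M: "\<And>e. valid_input n e \<Longrightarrow>
      valid_input n (override_on e \<sigma> M) \<and> (step A B n ^^ k) (s1, override_on e \<sigma> M) (s', e)"
    using Suc.IH[OF s1(2) sstep_valid[OF s1(1) Suc.prems(2)]] by blast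
  obtain p v where p: "p \<in> procs n" "v \<in> inputs (tmpl p)"
    "\<And>e. valid_input n e \<Longrightarrow> step A B n (s, e(p := v)) (s1, e)"
    by (rule sstep_lift[OF s1(1) Suc.prems(2)]) (rule that)
  \<comment> \<open>The step in front is now the first move of \<open>p\<close>, so \<open>v\<close>
    replaces any value that \<open>\<sigma>\<close> had there.\<close>
  have eq: "override_on e (\<sigma>(p := v)) (insert p M) = (override_on e \<sigma> M)(p := v)" for e
    by (auto simp: override_on_def)
  show ?case
  proof (intro exI allI impI conjI)
    fix e assume "valid_input n e"
    note e = M[OF this]
    show "valid_input n (override_on e (\<sigma>(p := v)) (insert p M))"
      unfolding eq using e p by (auto simp: valid_input_def)
    show "(step A B n ^^ Suc k) (s, override_on e (\<sigma>(p := v)) (insert p M)) (s', e)"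
      unfolding eq using e by (blast intro: relpowp_Suc_I2 p(3))
  qed
qed

lemma sstep_reach_lift:
  assumes "(sstep n)\<^sup>*\<^sup>* s s'" "valid_state n s" "valid_input n e"
  obtains e0 where "valid_input n e0" "(step A B n)\<^sup>*\<^sup>* (s, e0) (s', e)"
proof -
  obtain k where "(sstep n ^^ k) s s'" using assms(1) unfolding rtranclp_power by blast
  from sstep_power_lift[OF this assms(2)] show ?thesis
    using assms(3) that by (metis rtranclp_power)
qed

text \<open>Overriding inputs is idempotent, so a cycle of states lifts to a cycle of configurations.\<close>

lemma sstep_cycle_lift:
  assumes "(sstep n)\<^sup>+\<^sup>+ s s" "valid_state n s" "valid_input n e"
  obtains e0 where "valid_input n e0" "(step A B n)\<^sup>+\<^sup>+ (s, e0) (s, e0)"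
proof -
  obtain k where k: "0 < k" "(sstep n ^^ k) s s"
    using assms(1) unfolding tranclp_power by blast
  obtain M \<sigma> where M: "\<And>e. valid_input n e \<Longrightarrow>
      valid_input n (override_on e \<sigma> M) \<and> (step A B n ^^ k) (s, override_on e \<sigma> M) (s, e)"
    using sstep_power_lift[OF k(2) assms(2)] by blast
  define e0 where "e0 = override_on e \<sigma> M"
  have "override_on e0 \<sigma> M = e0" by (auto simp: e0_def override_on_def)
  moreover have "valid_input n e0" using M[OF assms(3)] by (simp add: e0_def)
  ultimately show ?thesis using M[of e0] k that[of e0] unfolding tranclp_power by auto
qed

section \<open>Simulation with a different number of copies\<close>

text \<open>The processes in \<open>I\<close> move one after another, and \<open>w\<close>, which
  stays put, satisfies the guard each time. The intermediate states are those in which part of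
  \<open>I\<close> has moved.\<close>

lemma sstep_all_move:
  assumes "finite I" "I \<subseteq> procs n" "w \<in> procs n - I" "y w \<in> g"
    and "\<And>p. p \<in> I \<Longrightarrow> (y p, \<sigma>, g, y' p) \<in> transitions (tmpl p)"
    and "\<And>p. p \<notin> I \<Longrightarrow> y' p = y p"
  shows "(sstep n)\<^sup>*\<^sup>* y y'"
proof -
  have "(sstep n)\<^sup>*\<^sup>* y (override_on y y' I)"
    using assms(1-5)
  proof (induction I)
    case (insert p I)
    have "sstep n (override_on y y' I) (override_on y y' (insert p I))"
      unfolding sstep_def
    proof (rule bexI[of _ p], intro exI conjI)
      show "(override_on y y' I p, \<sigma>, g, y' p) \<in> transitions (tmpl p)"
        using insert by (simp add: override_on_def)
      show "\<exists>p'\<in>procs n. p' \<noteq> p \<and> override_on y y' I p' \<in> g"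
        using insert by (intro bexI[of _ w]) (auto simp: override_on_def)
    qed (use insert in \<open>auto simp: override_on_def\<close>)
    then show ?case using insert by (auto intro: rtranclp.rtrancl_into_rtrancl)
  qed (simp add: override_on_def)
  moreover have "override_on y y' I = y'" using assms(6) by (auto simp: override_on_def)
  ultimately show ?thesis by simp
qed

text \<open>Each copy runs the shadow trajectory of its assigned state. All copies that change at
  one time imitate the single original mover, and the state of the guard witness is kept occupied by
  a copy that does not change.\<close>

lemma simulate_path:
  assumes n: "1 \<le> n" and m: "card (states B) \<le> m"
    and path: "\<And>t. t < N \<Longrightarrow> sstep n (s t) (s (Suc t))"
    and valid: "valid_state n (s 0)"
  obtains y where "\<And>t. t < N \<Longrightarrow> (sstep m)\<^sup>*\<^sup>* (y t) (y (Suc t))"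
    "\<And>t. y t = on_procs m (y t)"
    "\<And>t. y t PA = s t PA"
    "\<And>t j. t \<le> N \<Longrightarrow> j \<in> {1..n} \<Longrightarrow> \<exists>i\<in>{1..m}. y t (PB i) = s t (PB j)"
    "\<And>t i. t = 0 \<or> t = N \<Longrightarrow> i \<in> {1..m} \<Longrightarrow> \<exists>j\<in>{1..n}. y t (PB i) = s t (PB j)"
proof -
  have valid': "valid_state n (s t)" if "t \<le> N" for t
    using that by (induction t) (use valid sstep_valid[OF path] in auto)
  let ?P = "\<lambda>u \<tau>. (\<forall>t<N. \<tau> (Suc t) = \<tau> t \<or>
      (\<exists>j\<in>{1..n}. \<tau> t = s t (PB j) \<and> \<tau> (Suc t) = s (Suc t) (PB j))) \<and>
    \<tau> 0 \<in> (\<lambda>j. s 0 (PB j)) ` {1..n} \<and> \<tau> N \<in> (\<lambda>j. s N (PB j)) ` {1..n} \<and>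
    (\<forall>t\<le>N. \<forall>j\<in>{1..n}. s t (PB j) = u \<longrightarrow> \<tau> t = u)"
  have "\<exists>\<tau>. ?P u \<tau>" for u
  proof (rule shadow_trajectory[of "{1..n}" N "\<lambda>t j. s t (PB j)" u])
    show "{1..n} \<noteq> {}" using n by simp
  qed (intro exI conjI allI impI ballI)
  then obtain \<tau> where "\<And>u. ?P u (\<tau> u)" by metis
  then have traj: "\<And>u t. t < N \<Longrightarrow> \<tau> u (Suc t) = \<tau> u t \<or>
      (\<exists>j\<in>{1..n}. \<tau> u t = s t (PB j) \<and> \<tau> u (Suc t) = s (Suc t) (PB j))"
    and ends: "\<And>u. \<tau> u 0 \<in> (\<lambda>j. s 0 (PB j)) ` {1..n}" "\<And>u. \<tau> u N \<in> (\<lambda>j. s N (PB j)) ` {1..n}"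
    and cover: "\<And>t j. t \<le> N \<Longrightarrow> j \<in> {1..n} \<Longrightarrow> \<tau> (s t (PB j)) t = s t (PB j)"
    by blast+
  \<comment> \<open>Here \<open>m\<close> has to reach the number of states of \<open>B\<close>:
    every state needs a copy of its own. The index shift occurs because copies are numbered from
    1.\<close>
  obtain h where h: "states B \<subseteq> h ` {1..m}"
  proof -
    obtain h where "bij_betw h {0..<card (states B)} (states B)"
      using finite_states ex_bij_betw_nat_finite by blast
    then have "states B \<subseteq> (\<lambda>i. h (i - 1)) ` {1..m}"
      using m by (force simp: bij_betw_def image_iff)
    then show ?thesis using that by blast
  qed
  define y where
    "y t = on_procs m (\<lambda>p. case p of PA \<Rightarrow> s t PA | PB i \<Rightarrow> \<tau> (h i) t)" for t
  have yA: "y t PA = s t PA" for t by (simp add: y_def)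
  have yB: "y t (PB i) = \<tau> (h i) t" if "i \<in> {1..m}" for t i using that by (simp add: y_def)
  \<comment> \<open>The copy \<open>i\<close> is chosen before the time \<open>t\<close>, so the
    same copy holds \<open>u\<close> at consecutive times.\<close>
  have keeper: "\<exists>i\<in>{1..m}. \<forall>t\<le>N. u \<in> (\<lambda>j. s t (PB j)) ` {1..n} \<longrightarrow> y t (PB i) = u"
    if "u \<in> states B" for u
  proof -
    obtain i where "i \<in> {1..m}" "h i = u" using h \<open>u \<in> states B\<close> by blast
    then show ?thesis using cover yB by (intro bexI[of _ i]) auto
  qed
  have stB: "s t (PB j) \<in> states B" if "t \<le> N" "j \<in> {1..n}" for t j
    using valid'[OF that(1)] that(2) by (auto simp: valid_state_def all_procs_iff)
  have "(sstep m)\<^sup>*\<^sup>* (y t) (y (Suc t))" if t: "t < N" for t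
  proof -
    obtain p \<sigma> g r p' where p: "p \<in> procs n" "(s t p, \<sigma>, g, r) \<in> transitions (tmpl p)"
      and p': "p' \<in> procs n" "p' \<noteq> p" "s t p' \<in> g" and s': "s (Suc t) = (s t)(p := r)"
      using path[OF t] unfolding sstep_def by blast
    \<comment> \<open>Only processes whose state changes have to move. A self-loop is imitated by no
      step at all, whence the reflexive closure.\<close>
    define I where "I = {p \<in> procs m. y (Suc t) p \<noteq> y t p}"
    \<comment> \<open>The original witness \<open>p'\<close> stands still, so its state is occupied
      at both \<open>t\<close> and \<open>Suc t\<close>; \<open>PA\<close> itself or the keeper of
      that state therefore does not change.\<close>
    have "\<exists>w\<in>procs m - I. y t w \<in> g"
    proof (cases p')
      case PA
      then have "y (Suc t) PA = y t PA" using p' s' by (simp add: yA)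
      then show ?thesis using PA p' by (intro bexI[of _ PA]) (auto simp: I_def yA)
    next
      case (PB j)
      then have j: "j \<in> {1..n}" "s (Suc t) (PB j) = s t (PB j)" using p' s' by auto
      obtain i where i: "i \<in> {1..m}"
        "\<forall>t'\<le>N. s t (PB j) \<in> (\<lambda>j. s t' (PB j)) ` {1..n} \<longrightarrow> y t' (PB i) = s t (PB j)"
        using keeper[OF stB[OF _ j(1)], of t] t by auto
      have "y t (PB i) = s t (PB j)" using i(2) t j(1) by auto
      moreover have "s t (PB j) \<in> (\<lambda>j. s (Suc t) (PB j)) ` {1..n}"
        using j by (intro image_eqI[of _ _ j]) auto
      then have "y (Suc t) (PB i) = s t (PB j)" using i(2) t by auto
      ultimately show ?thesis using i(1) p' PB by (intro bexI[of _ "PB i"]) (auto simp: I_def)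
    qed
    then obtain w where w: "w \<in> procs m - I" "y t w \<in> g" by blast
    \<comment> \<open>A changing copy imitates a changing original process, and \<open>p\<close> is
      the only one at this step.\<close>
    have same: "tmpl p0 = tmpl p \<and> y t p0 = s t p \<and> y (Suc t) p0 = r" if "p0 \<in> I" for p0
    proof (cases p0)
      case PA
      then have "p = PA" using that s' by (auto simp: I_def yA split: if_splits)
      then show ?thesis using PA s' by (simp add: yA)
    next
      case (PB i)
      then have i: "i \<in> {1..m}" using that by (auto simp: I_def)
      then obtain j where j: "j \<in> {1..n}" "\<tau> (h i) t = s t (PB j)" "\<tau> (h i) (Suc t) = s (Suc t) (PB j)"
        using traj[OF t, of "h i"] \<open>p0 \<in> I\<close> PB by (auto simp: I_def yB)
      then have "p = PB j" using that PB i s' by (auto simp: I_def yB split: if_splits)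
      then show ?thesis using PB i j s' by (simp add: yB)
    qed
    show ?thesis
    proof (rule sstep_all_move[of I m w "y t" g \<sigma>])
      show "(y t p0, \<sigma>, g, y (Suc t) p0) \<in> transitions (tmpl p0)" if "p0 \<in> I" for p0
        using same[OF that] p by simp
      show "y (Suc t) p0 = y t p0" if "p0 \<notin> I" for p0
        using that by (auto simp: I_def y_def on_procs_def)
    qed (use w in \<open>auto simp: I_def\<close>)
  qed
  moreover have "\<exists>i\<in>{1..m}. y t (PB i) = s t (PB j)" if "t \<le> N" "j \<in> {1..n}" for t j
    using keeper[OF stB[OF that]] that by blast
  moreover have "\<exists>j\<in>{1..n}. y t (PB i) = s t (PB j)" if "t = 0 \<or> t = N" "i \<in> {1..m}" for t i
    using ends[of "h i"] that by (auto simp: yB)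
  moreover have "y t = on_procs m (y t)" for t by (auto simp: y_def on_procs_def)
  ultimately show ?thesis using that yA by blast
qed

section \<open>Paths and cycles between uniform states\<close>

abbreviation ustate :: "nat \<Rightarrow> 's \<Rightarrow> 's \<Rightarrow> proc \<Rightarrow> 's" where
  "ustate n a b \<equiv> on_procs n (uniform a b)"

lemma ustate_eqI:
  assumes "y = on_procs m y" "y PA = a" "\<And>i. i \<in> {1..m} \<Longrightarrow> y (PB i) = b"
  shows "y = ustate m a b"
proof -
  have "on_procs m y = ustate m a b"
    unfolding on_procs_eq_iff all_procs_iff using assms(2,3) by simp
  then show ?thesis using assms(1) by argo
qed

text \<open>At both ends every simulating copy is in a state of some original copy, so uniform
  endpoints stay uniform.\<close>

lemma simulate_reach:
  assumes "1 \<le> n" "card (states B) \<le> m" "a \<in> states A" "b \<in> states B"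
    and "(sstep n)\<^sup>*\<^sup>* (ustate n a b) (ustate n a' b')"
  shows "(sstep m)\<^sup>*\<^sup>* (ustate m a b) (ustate m a' b')"
proof -
  obtain N s where "is_path (sstep n) N s (ustate n a b) (ustate n a' b')"
    using assms(5) unfolding rtranclp_iff_path by blast
  note s = is_pathD[OF this]
  have v: "valid_state n (s 0)" using assms s by (simp add: valid_state_uniform)
  obtain y where y: "\<And>t. t < N \<Longrightarrow> (sstep m)\<^sup>*\<^sup>* (y t) (y (Suc t))"
    "\<And>t. y t = on_procs m (y t)" "\<And>t. y t PA = s t PA"
    "\<And>t j. t \<le> N \<Longrightarrow> j \<in> {1..n} \<Longrightarrow> \<exists>i\<in>{1..m}. y t (PB i) = s t (PB j)"
    "\<And>t i. t = 0 \<or> t = N \<Longrightarrow> i \<in> {1..m} \<Longrightarrow> \<exists>j\<in>{1..n}. y t (PB i) = s t (PB j)"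
    proof (rule simulate_path[where s = s and N = N, OF assms(1,2) _ v], goal_cases)
    case 1
    then show ?case using s(3) by blast
  next
    case (2 y)
    show ?case by (rule that[of y]) (fact 2(2-))+
  qed
  have "y 0 = ustate m a b" "y N = ustate m a' b'"
    using y(3) y(5)[of 0] y(5)[of N] s by (auto intro!: ustate_eqI y(2))
  then show ?thesis using rtranclp_chain[of N "sstep m" y 0 N] y(1) by simp
qed

text \<open>In a uniform state all copies of \<open>B\<close> are interchangeable, and copy 1
  represents them.\<close>

fun leader :: "proc \<Rightarrow> proc" where
  "leader PA = PA"
| "leader (PB i) = PB 1"

text \<open>If mover and witness are both copies of \<open>B\<close>, the mover becomes copy 1 and
  the witness copy 2; this is where two copies are required.\<close>

lemma leader_witness:
  assumes "p' \<noteq> p" "2 \<le> m"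
  obtains r where "r \<in> procs m" "r \<noteq> leader p" "uniform a b r = uniform a b p'"
proof (cases p')
  case PA
  then show ?thesis using that[of PA] assms by (cases p) auto
next
  case (PB i)
  show ?thesis
  proof (cases p)
    case PA
    then show ?thesis using PB that[of "PB 1"] assms by auto
  next
    case (PB j)
    then show ?thesis using \<open>p' = PB i\<close> that[of "PB 2"] assms by auto
  qed
qed

lemma leader_simps [simp]: "uniform a b (leader p) = uniform a b p" "tmpl (leader p) = tmpl p"
  "leader p \<in> procs n \<longleftrightarrow> p = PA \<or> 1 \<le> n"
  by (cases p; simp)+

lemma sstep_ustate_leader:
  assumes "p \<in> procs n" "p' \<in> procs n" "p' \<noteq> p" "(uniform a b p, \<sigma>, g, r) \<in> transitions (tmpl p)"
    "uniform a b p' \<in> g" "2 \<le> m"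
  shows "sstep m (ustate m a b) ((ustate m a b)(leader p := r))"
proof -
  obtain w where "w \<in> procs m" "w \<noteq> leader p" "uniform a b w = uniform a b p'"
    using leader_witness[OF assms(3,6)] .
  then show ?thesis unfolding sstep_def using assms
    by (intro bexI[of _ "leader p"] exI[of _ \<sigma>] exI[of _ g] exI[of _ r]) auto
qed

text \<open>The simulation of a cycle could be empty, so a nonempty one has to be found, if
  necessary from a self-loop.\<close>

lemma simulate_cycle:
  assumes "2 \<le> n" "2 \<le> m" "card (states B) \<le> m" "a \<in> states A" "b \<in> states B"
    and "(sstep n)\<^sup>+\<^sup>+ (ustate n a b) (ustate n a b)"
  shows "(sstep m)\<^sup>+\<^sup>+ (ustate m a b) (ustate m a b)"
proof -
  obtain N s where N: "0 < N" and "is_path (sstep n) N s (ustate n a b) (ustate n a b)"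
    using assms(6) unfolding tranclp_iff_path by blast
  note s = is_pathD[OF this(2)]
  have v: "valid_state n (s 0)" using assms s by (simp add: valid_state_uniform)
  have n: "1 \<le> n" using assms by simp
  obtain y where y: "\<And>t. t < N \<Longrightarrow> (sstep m)\<^sup>*\<^sup>* (y t) (y (Suc t))"
    "\<And>t. y t = on_procs m (y t)" "\<And>t. y t PA = s t PA"
    "\<And>t j. t \<le> N \<Longrightarrow> j \<in> {1..n} \<Longrightarrow> \<exists>i\<in>{1..m}. y t (PB i) = s t (PB j)"
    "\<And>t i. t = 0 \<or> t = N \<Longrightarrow> i \<in> {1..m} \<Longrightarrow> \<exists>j\<in>{1..n}. y t (PB i) = s t (PB j)"
    proof (rule simulate_path[where s = s and N = N, OF n assms(3) _ v], goal_cases)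
    case 1
    then show ?case using s(3) by blast
  next
    case (2 y)
    show ?case by (rule that[of y]) (fact 2(2-))+
  qed
  have ends: "y 0 = ustate m a b" "y N = ustate m a b"
    using y(3) y(5)[of 0] y(5)[of N] s by (auto intro!: ustate_eqI y(2))
  show ?thesis
  \<comment> \<open>If the simulation has left the start by time 1, it is a nonempty cycle;
    otherwise the first original step is examined.\<close>
  proof (cases "y 1 = ustate m a b")
    case False
    have "(sstep m)\<^sup>*\<^sup>* (y 0) (y 1)" "(sstep m)\<^sup>*\<^sup>* (y 1) (y N)"
      using rtranclp_chain[of N "sstep m" y] y(1) N by simp_all
    then show ?thesis using False ends by (metis rtranclpD tranclp_rtranclp_tranclp)
  next
    case True
    obtain p \<sigma> g r p' where p: "p \<in> procs n" "(s 0 p, \<sigma>, g, r) \<in> transitions (tmpl p)"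
      and p': "p' \<in> procs n" "p' \<noteq> p" "s 0 p' \<in> g" and s1: "s 1 = (s 0)(p := r)"
      using s(3)[OF N] unfolding sstep_def One_nat_def by blast
    \<comment> \<open>By covering, every state of an original copy at time 1 occurs among the
      simulating copies, which are all in \<open>b\<close>. So the first step is a self-loop, which
      a representative can repeat.\<close>
    have "s 1 p = uniform a b p"
    proof (cases p)
      case PA
      then show ?thesis using y(3)[of 1] True by simp
    next
      case (PB j)
      then show ?thesis using y(4)[of 1 j] True N p by auto
    qed
    then have "r = uniform a b p" using s1 by simp
    then have "(ustate m a b)(leader p := r) = ustate m a b"
      using assms(2) by (auto simp: fun_eq_iff)
    then have "sstep m (ustate m a b) (ustate m a b)"
      using sstep_ustate_leader[of p n p' a b \<sigma> g r m] p p' s assms(2) by simp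
    then show ?thesis by blast
  qed
qed

section \<open>Deadlocks and inputs in uniform states\<close>

text \<open>A move of \<open>p\<close> from the uniform configuration would give a move of
  \<open>leader p\<close> in \<open>c\<close>, as every copy has been given the input of copy 1. Two
  copies in \<open>c\<close> ensure a guard witness.\<close>

lemma deadlock_transfer:
  assumes n: "2 \<le> n" and valid: "valid_config A B n c" and b: "all_B_in n b c"
    and dead: "\<nexists>c'. step A B n c c'"
  shows "\<nexists>c'. step A B m (ustate m (fst c PA) b, snd c \<circ> leader) c'"
proof
  let ?a = "fst c PA"
  assume "\<exists>c'. step A B m (ustate m ?a b, snd c \<circ> leader) c'"
  then obtain p g r p' where p: "p \<in> procs m" "p' \<in> procs m" "p' \<noteq> p"
    and tr: "(uniform ?a b p, snd c (leader p), g, r) \<in> transitions (tmpl p)"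
    and g: "uniform ?a b p' \<in> g"
    by (auto simp: step_def moves_def)
  have c: "fst c p0 = uniform ?a b p0" if "p0 \<in> procs n" for p0
    using b that by (cases p0) (auto simp: all_B_in_def)
  obtain w where w: "w \<in> procs n" "w \<noteq> leader p" "uniform ?a b w = uniform ?a b p'"
    using leader_witness[OF p(3) n] .
  have l: "leader p \<in> procs n" using n by simp
  \<comment> \<open>The mover keeps its old input, which is a valid choice of new input.\<close>
  let ?c' = "((fst c)(leader p := r), snd c)"
  have "valid_config A B n ?c'"
    using valid transition_closed(3)[OF tr] by (auto simp: valid_config_def)
  moreover have "(fst c (leader p), snd c (leader p), g, fst ?c' (leader p)) \<in> transitions (tmpl (leader p))"
    using tr c[OF l] by simp
  moreover have "fst c w \<in> g" using c[OF w(1)] w g by simp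
  ultimately have "moves A B n (leader p) c ?c'"
    unfolding moves_def using valid l w by auto
  then show False using dead by (auto simp: step_def)
qed

lemma valid_input_leader: "valid_input n e \<Longrightarrow> 1 \<le> n \<Longrightarrow> valid_input m (e \<circ> leader)"
  unfolding valid_input_def by (metis comp_apply leader_simps(2,3))

section \<open>Runs and their extension\<close>

lemma run_valid:
  assumes "is_run A B n L x" "enat t < L"
  shows "valid_config A B n (x t)"
  using assms
  by (cases t) (auto simp: is_run_def initial_config_def step_def moves_def)

lemma run_sstep:
  assumes "is_run A B n L x" "enat t' < L" "t \<le> t'"
  shows "(sstep n)\<^sup>*\<^sup>* (on_procs n (fst (x t))) (on_procs n (fst (x t')))"
proof (rule rtranclp_chain[where y = "\<lambda>t. on_procs n (fst (x t))" and k = t'])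
  fix k assume "k < t'"
  then have "enat (Suc k) < L" using assms(2) by (metis Suc_leI enat_ord_simps(1) le_less_trans)
  then show "(sstep n)\<^sup>*\<^sup>* (on_procs n (fst (x k))) (on_procs n (fst (x (Suc k))))"
    using assms(1) by (intro r_into_rtranclp step_imp_sstep) (simp add: is_run_def)
qed (use assms in auto)

lemma run_init:
  assumes "is_run A B n L x"
  shows "on_procs n (fst (x 0)) = ustate n (init A) (init B)"
  using assms by (auto simp: is_run_def initial_config_def on_procs_eq_iff all_procs_iff)

lemma initial_lift:
  assumes "(sstep m)\<^sup>*\<^sup>* (ustate m (init A) (init B)) s" "valid_input m e"
  obtains c where "initial_config A B m c" "(step A B m)\<^sup>*\<^sup>* c (s, e)"
proof -
  have v: "valid_state m (ustate m (init A) (init B))"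
    using init_states by (simp add: valid_state_uniform)
  obtain e0 where "valid_input m e0" "(step A B m)\<^sup>*\<^sup>* (ustate m (init A) (init B), e0) (s, e)"
    using sstep_reach_lift[OF assms(1) v assms(2)] .
  then show ?thesis using v
    by (intro that) (auto simp: initial_config_def valid_config_iff all_procs_iff)
qed

text \<open>Simulate the path of states and lift it backwards from \<open>e\<close>. The free choice
  of \<open>e\<close> allows arrival at a prescribed deadlock or at the start of a lifted
  cycle.\<close>

lemma run_reach:
  assumes run: "is_run A B n L x" "enat t < L" "all_B_in n q (x t)"
    and "1 \<le> n" "card (states B) \<le> m" "valid_input m e"
  obtains c where "initial_config A B m c" "(step A B m)\<^sup>*\<^sup>* c (ustate m (fst (x t) PA) q, e)"
proof -
  have "(sstep n)\<^sup>*\<^sup>* (ustate n (init A) (init B)) (ustate n (fst (x t) PA) q)"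
    using run_sstep[OF run(1,2), of 0] run_init[OF run(1)] run(3) by (simp add: all_B_in_iff)
  from simulate_reach[OF assms(4,5) init_states this] show ?thesis
    using initial_lift assms(6) that by blast
qed

lemma deadlock_run:
  assumes "initial_config A B n c" "(step A B n)\<^sup>*\<^sup>* c d" "\<nexists>c'. step A B n d c'"
  obtains k x where "is_run A B n (enat (Suc k)) x" "x k = d"
proof -
  obtain k x where "is_path (step A B n) k x c d"
    using assms(2) unfolding rtranclp_iff_path by blast
  note is_pathD[OF this]
  then show ?thesis using assms by (intro that[of k x]) (auto simp: is_run_def zero_enat_def)
qed

text \<open>Either a deadlock is reachable from \<open>d\<close> and ends the run, or every
  configuration reachable from \<open>d\<close> has a successor and dependent choice continues
  forever.\<close>

lemma extend_to_run:
  assumes init: "initial_config A B n c" and reach: "(step A B n)\<^sup>*\<^sup>* c d"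
  obtains L x k where "is_run A B n L x" "enat k < L" "x k = d"
proof (cases "\<exists>d'. (step A B n)\<^sup>*\<^sup>* d d' \<and> (\<nexists>c'. step A B n d' c')")
  case True
  then obtain d' where d': "(step A B n)\<^sup>*\<^sup>* d d'" "\<nexists>c'. step A B n d' c'" by blast
  obtain k f where "is_path (step A B n) k f c d" using reach unfolding rtranclp_iff_path by blast
  note f = is_pathD[OF this]
  obtain l g where "is_path (step A B n) l g d d'" using d'(1) unfolding rtranclp_iff_path by blast
  note g = is_pathD[OF this]
  define x where "x i = (if i < k then f i else g (i - k))" for i
  have st: "step A B n (x i) (x (Suc i))" if "i < k + l" for i
  proof -
    consider "Suc i < k" | "Suc i = k" | "k \<le> i" by linarith
    then show ?thesis
      using that f g(1) g(3)[of "i - k"] f(3)[of i] by cases (auto simp: x_def Suc_diff_le)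
  qed
  have x: "x 0 = c" "x k = d" "x (k + l) = d'"
    using f g by (cases k; simp add: x_def)+
  \<comment> \<open>Lengths count configurations, one more than the \<open>k + l\<close>
    steps.\<close>
  have "is_run A B n (enat (Suc (k + l))) x"
    using st x init d' by (auto simp: is_run_def zero_enat_def)
  then show ?thesis using that[of _ x k] x by simp
next
  case False
  obtain k f where "is_path (step A B n) k f c d" using reach unfolding rtranclp_iff_path by blast
  note f = is_pathD[OF this]
  let ?R = "\<lambda>d'. (step A B n)\<^sup>*\<^sup>* d d'"
  obtain g where g: "g 0 = d" "\<And>i. ?R (g i)" "\<And>i. step A B n (g i) (g (Suc i))"
  \<comment> \<open>The invariant is reachability from \<open>d\<close>; its second conjunct fixes
    the first element.\<close>
  proof (rule exE[OF dependent_nat_choice[of "\<lambda>i d'. ?R d' \<and> (i = 0 \<longrightarrow> d' = d)" "\<lambda>_. step A B n"]])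
    show "\<exists>x. ?R x \<and> (0 = 0 \<longrightarrow> x = d)" by blast
    show "\<exists>y. (?R y \<and> (Suc i = 0 \<longrightarrow> y = d)) \<and> step A B n x y" if "?R x \<and> (i = 0 \<longrightarrow> x = d)" for x i
      using that False by (metis old.nat.distinct(2) rtranclp.rtrancl_into_rtrancl)
  qed (use that in blast)
  define x where "x i = (if i < k then f i else g (i - k))" for i
  have st: "step A B n (x i) (x (Suc i))" for i
  proof -
    consider "Suc i < k" | "Suc i = k" | "k \<le> i" by linarith
    then show ?thesis
      using f g(1) g(3)[of "i - k"] f(3)[of i] by cases (auto simp: x_def Suc_diff_le)
  qed
  have x: "x 0 = c" "x k = d"
    using f g by (cases k; simp add: x_def)+
  have "is_run A B n \<infinity> x"
    using st x init by (auto simp: is_run_def)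
  then show ?thesis using that[of _ x k] x by simp
qed

lemma all_B_in_ustate [simp]: "all_B_in m q (ustate m a q, e)"
  by (simp add: all_B_in_def)

section \<open>Transfer of the target properties\<close>

lemma target_transfer:
  assumes "1 \<le> n" "card (states B) \<le> m" "has_target_run A B q n"
  shows "has_target_run A B q m"
proof -
  obtain L x t where run: "is_run A B n L x" "enat t < L" "all_B_in n q (x t)"
    using assms(3) by (auto simp: has_target_run_def ltl_F_def)
  \<comment> \<open>Any valid inputs would do, but the alphabets are not assumed nonempty, so they
    are taken from the given run.\<close>
  have "valid_input m (snd (x t) \<circ> leader)"
    using run_valid[OF run(1,2)] assms(1) by (simp add: valid_config_iff valid_input_leader[of n])
  then obtain c d where "initial_config A B m c" "(step A B m)\<^sup>*\<^sup>* c d" "all_B_in m q d"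
    using run_reach[OF run assms(1,2)] all_B_in_ustate by metis
  then obtain L' x' k where "is_run A B m L' x'" "enat k < L'" "all_B_in m q (x' k)"
    using extend_to_run by metis
  then show ?thesis by (auto simp: has_target_run_def ltl_F_def)
qed

text \<open>Since \<open>states A\<close> is finite, two target positions agree in the state of
  \<open>A\<close> and hence as global states. The cycle between them is simulated, lifted and
  unrolled.\<close>

lemma infinitely_often_transfer:
  assumes q: "q \<in> states B" and n: "2 \<le> n" and m: "2 \<le> m" "card (states B) \<le> m"
    and "has_infinitely_often_target_run A B q n"
  shows "\<exists>x. is_run A B m \<infinity> x \<and> infinite {t. all_B_in m q (x t)}"
proof -
  obtain L x where run: "is_run A B n L x" and inf: "infinite {t. enat t < L \<and> all_B_in n q (x t)}"
    (is "infinite ?S")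
    using assms(5) by (auto simp: has_infinitely_often_target_run_def)
  have A: "fst (x t) PA \<in> states A" if "enat t < L" for t
    using run_valid[OF run that] by (auto simp: valid_config_def all_procs_iff)
  have "finite ((\<lambda>t. fst (x t) PA) ` ?S)"
    by (rule finite_subset[OF _ finite_states(1)]) (use A in auto)
  then obtain t where t: "t \<in> ?S" "infinite {t' \<in> ?S. fst (x t') PA = fst (x t) PA}"
    using pigeonhole_infinite[OF inf] by blast
  then obtain t' where t': "t < t'" "t' \<in> ?S" "fst (x t') PA = fst (x t) PA"
    by (metis (mono_tags, lifting) infinite_nat_iff_unbounded mem_Collect_eq)
  define a where "a = fst (x t) PA"
  have a: "a \<in> states A" using A t by (simp add: a_def)
  have s: "on_procs n (fst (x t)) = ustate n a q" "on_procs n (fst (x t')) = ustate n a q"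
    using t t' by (auto simp: a_def all_B_in_iff)
  \<comment> \<open>The first step is split off to make the cycle nonempty.\<close>
  have "enat (Suc t) < L" using t'
    by (metis (mono_tags, lifting) Suc_leI enat_ord_simps(1) le_less_trans mem_Collect_eq)
  then have "sstep n (ustate n a q) (on_procs n (fst (x (Suc t))))"
    using run step_imp_sstep s by (metis is_run_def)
  moreover have "(sstep n)\<^sup>*\<^sup>* (on_procs n (fst (x (Suc t)))) (ustate n a q)"
    using run_sstep[OF run, of t' "Suc t"] t' s by auto
  ultimately have "(sstep n)\<^sup>+\<^sup>+ (ustate n a q) (ustate n a q)" by auto
  from simulate_cycle[OF n m a q this]
  have cyc: "(sstep m)\<^sup>+\<^sup>+ (ustate m a q) (ustate m a q)" .
  have "valid_input m (snd (x t) \<circ> leader)"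
    using run_valid[OF run] t n by (simp add: valid_config_iff valid_input_leader[of n])
  moreover have "valid_state m (ustate m a q)" using a q by (simp add: valid_state_uniform)
  ultimately obtain e where e: "valid_input m e"
    "(step A B m)\<^sup>+\<^sup>+ (ustate m a q, e) (ustate m a q, e)"
    using sstep_cycle_lift[OF cyc] by blast
  \<comment> \<open>The stem is made to end with the very inputs \<open>e\<close> at which the
    lifted cycle closes.\<close>
  obtain c where c: "initial_config A B m c" "(step A B m)\<^sup>*\<^sup>* c (ustate m a q, e)"
    using run_reach[OF run, of t q m e] t n m e(1) by (auto simp: a_def)
  obtain f where f: "f 0 = c" "\<And>i. step A B m (f i) (f (Suc i))" "infinite {i. f i = (ustate m a q, e)}"
    using lasso_sequence[OF c(2) e(2)] by metis
  have "is_run A B m \<infinity> f" using f c by (auto simp: is_run_def)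
  moreover have "infinite {i. all_B_in m q (f i)}"
    by (rule infinite_super[OF _ f(3)]) auto
  ultimately show ?thesis by blast
qed

text \<open>For an infinite run GF means infinitely many target positions; for a finite run it means
  that the final deadlock is in the target.\<close>

lemma repeat_transfer:
  assumes q: "q \<in> states B" and n: "2 \<le> n" and m: "2 \<le> m" "card (states B) \<le> m"
    and "has_repeat_target_run A B q n"
  shows "has_repeat_target_run A B q m"
proof -
  obtain L x where run: "is_run A B n L x" and GF: "ltl_GF L x (all_B_in n q)"
    using assms(5) by (auto simp: has_repeat_target_run_def)
  show ?thesis
  proof (cases L)
    case infinity
    then have "\<forall>i. \<exists>k\<ge>i. all_B_in n q (x k)" using GF by (simp add: ltl_GF_def)
    then have "infinite {t. enat t < L \<and> all_B_in n q (x t)}"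
      using infinity by (simp add: infinite_nat_iff_unbounded_le)
    then have "has_infinitely_often_target_run A B q n"
      using run by (auto simp: has_infinitely_often_target_run_def)
    from infinitely_often_transfer[OF q n m this] obtain x' where
      x': "is_run A B m \<infinity> x'" "infinite {t. all_B_in m q (x' t)}" by blast
    then have "ltl_GF \<infinity> x' (all_B_in m q)"
      by (simp add: ltl_GF_def infinite_nat_iff_unbounded_le)
    with x'(1) show ?thesis unfolding has_repeat_target_run_def by blast
  next
    case (enat l)
    then obtain t where L: "L = enat (Suc t)"
      using run by (cases l) (auto simp: is_run_def zero_enat_def)
    then have t: "enat t < L" by simp
    then obtain k where "t \<le> k" "enat k < L" "all_B_in n q (x k)"
      using GF unfolding ltl_GF_def by blast
    \<comment> \<open>\<open>t\<close> is the last position of the run.\<close>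
    moreover from this have "k = t" using L by simp
    ultimately have all_q: "all_B_in n q (x t)" by simp
    have dead: "\<nexists>c'. step A B n (x t) c'" using run L by (auto simp: is_run_def)
    have v: "valid_config A B n (x t)" by (rule run_valid[OF run t])
    have "valid_input m (snd (x t) \<circ> leader)"
      using v n by (simp add: valid_config_iff valid_input_leader[of n])
    then obtain c where
      c: "initial_config A B m c"
        "(step A B m)\<^sup>*\<^sup>* c (ustate m (fst (x t) PA) q, snd (x t) \<circ> leader)"
      using run_reach[OF run t all_q, of m] n m by auto
    obtain k x' where x': "is_run A B m (enat (Suc k)) x'"
      "x' k = (ustate m (fst (x t) PA) q, snd (x t) \<circ> leader)"
      using deadlock_run[OF c deadlock_transfer[OF n v all_q dead]] .
    then have "ltl_GF (enat (Suc k)) x' (all_B_in m q)"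
      unfolding ltl_GF_def by (intro allI impI exI[of _ k]) simp
    with x' show ?thesis by (auto simp: has_repeat_target_run_def)
  qed
qed

text \<open>With a single state every valid configuration is in the target, so both properties only
  ask for a run. This covers cutoff 1, where a second copy may be missing.\<close>

lemma repeat_eq_target:
  assumes "states B = {q}"
  shows "has_repeat_target_run A B q n = has_target_run A B q n"
proof -
  have "all_B_in n q (x t)" if "is_run A B n L x" "enat t < L" for L x t
    using run_valid[OF that] assms by (auto simp: valid_config_def all_B_in_def all_procs_iff)
  moreover have "enat 0 < L" if "is_run A B n L x" for L x
    using that by (simp add: is_run_def zero_enat_def)
  ultimately show ?thesis
    unfolding has_repeat_target_run_def has_target_run_def ltl_GF_def ltl_F_def by blast
qed

end

section \<open>Cutoffs\<close>

text \<open>The premise is symmetric in \<open>n\<close> and \<open>m\<close>, so one simulation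
  between arbitrary sizes gives both directions.\<close>

lemma is_cutoffI:
  assumes "\<And>n m. c \<le> n \<Longrightarrow> c \<le> m \<Longrightarrow> P n \<Longrightarrow> P m"
  shows "is_cutoff c P"
  using assms by (auto simp: is_cutoff_def)

theorem theorem7:
  fixes A B :: "('s, 'i) process_template" and q :: 's
  assumes "template_pair A B" and "q \<in> states B"
  shows "is_cutoff (card (states B)) (has_target_run A B q) \<and>
         is_cutoff (card (states B)) (has_repeat_target_run A B q) \<and>
         (2 \<le> card (states B) \<longrightarrow>
            is_cutoff (card (states B)) (has_infinitely_often_target_run A B q))"
proof -
  interpret disjunctive_system A B using assms(1) by unfold_locales
  have target: "is_cutoff (card (states B)) (has_target_run A B q)"
  proof (rule is_cutoffI)
    fix n m
    assume "card (states B) \<le> n" "card (states B) \<le> m" "has_target_run A B q n"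
    then show "has_target_run A B q m" using target_transfer[of n m q] card_B_pos by linarith
  qed
  moreover have "is_cutoff (card (states B)) (has_repeat_target_run A B q)"
  proof (cases "2 \<le> card (states B)")
    case True
    show ?thesis
    proof (rule is_cutoffI)
      fix n m
      assume "card (states B) \<le> n" "card (states B) \<le> m" "has_repeat_target_run A B q n"
      then show "has_repeat_target_run A B q m"
        using repeat_transfer[of q n m] assms(2) True by linarith
    qed
  next
    case False
    then have "card (states B) = 1" using card_B_pos by linarith
    then have "states B = {q}" using assms(2) by (auto simp: card_1_singleton_iff)
    then have "has_repeat_target_run A B q = has_target_run A B q"
      using repeat_eq_target by blast
    then show ?thesis using target by simp
  qed
  moreover have "is_cutoff (card (states B)) (has_infinitely_often_target_run A B q)"
    if "2 \<le> card (states B)"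
  proof (rule is_cutoffI)
    fix n m
    assume nm: "card (states B) \<le> n" "card (states B) \<le> m"
      and n: "has_infinitely_often_target_run A B q n"
    have "2 \<le> n" "2 \<le> m" using nm that by linarith+
    from infinitely_often_transfer[OF assms(2) this nm(2) n] obtain x
      where "is_run A B m \<infinity> x" "infinite {t. all_B_in m q (x t)}" by blast
    then show "has_infinitely_often_target_run A B q m"
      unfolding has_infinitely_often_target_run_def by (intro exI[of _ \<infinity>] exI[of _ x]) simp
  qed
  ultimately show ?thesis by blast
qed

end
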